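(* If $U:\mathbb R\to\mathbb R$ is a PSAHARA utility function, then its concave envelope $U^{**}$ is also a PSAHARA utility function. Further, even if $U$ is not a PSAHARA utility function, $U^{**}$ may be a PSAHARA utility function; that is, there exists a function $U:\mathbb R\to\mathbb R$ which is not a PSAHARA utility function but whose concave envelope $U^{**}$ is one.
   Context: For $\alpha\ge0$, $\beta>0$, $d\in\mathbb R$ and $x\in\mathbb R$, let $$\hat U(x;\alpha,\beta,d)=-\frac1{\alpha^2-1}\left((x-d)+\sqrt{\beta^2+(x-d)^2}\right)^{-\alpha}\left((x-d)+\alpha\sqrt{\beta^2+(x-d)^2}\right)\quad(\alpha\ne1),$$ $$\hat U(x;1,\beta,d)=\tfrac12\log\left((x-d)+\sqrt{\beta^2+(x-d)^2}\right)+\tfrac12\beta^{-2}(x-d)\left(\sqrt{\beta^2+(x-d)^2}-(x-d)\right).$$ A function $U:\mathbb R\to\mathbb R$ is a PSAHARA (piecewise SAHARA) utility function if there are $n\ge0$, a partition $-\infty=a_0<a_1<\dots<a_n<a_{n+1}=\infty$ and parameters $\alpha_k\ge0,\beta_k>0,d_k\in\mathbb R,\gamma_k>0,u_k\in\mathbb R$ ($k=0,\dots,n$) such that $U$ is increasing and continuous on $\mathbb R$ and $U(x)=\gamma_k\hat U(x;\alpha_k,\beta_k,d_k)+u_k$ for all $x\in(a_k,a_{k+1})$, $k=0,\dots,n$. The concave envelope $U^{**}$ of $U:\mathbb R\to\mathbb R$ is the smallest continuous concave function that is $\ge U$: $U^{**}(x)=\inf\{h(x): h:\mathbb R\to\mathbb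 R$ concave and continuous, $h\ge U\}$.
   Formalization: The first claim is proved for PSAHARA U having at least one continuous concave majorant, i.e. when U** is real-valued; without this it fails, e.g. U(x)=x for x<0, U(x)=2x for x≥0 (pieces with α=0) has no concave majorant. *)

theory Defs
  imports "HOL-Analysis.Analysis"
begin

definition sahara_hat :: "real \<Rightarrow> real \<Rightarrow> real \<Rightarrow> real \<Rightarrow> real" where
  "sahara_hat x \<alpha> \<beta> d =
     (if \<alpha> = 1 then
        1/2 * ln ((x - d) + sqrt (\<beta>\<^sup>2 + (x - d)\<^sup>2))
        + 1/2 * (1 / \<beta>\<^sup>2) * (x - d) * (sqrt (\<beta>\<^sup>2 + (x - d)\<^sup>2) - (x - d))
      else
        - (1 / (\<alpha>\<^sup>2 - 1)) * ((x - d) + sqrt (\<beta>\<^sup>2 + (x - d)\<^sup>2)) powr (- \<alpha>)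
        * ((x - d) + \<alpha> * sqrt (\<beta>\<^sup>2 + (x - d)\<^sup>2)))"

(* The breakpoints a 0, ..., a (n + 1) are extended reals, so that a 0 = -\<infinity> and a (n + 1) = \<infinity>.
   The derivative of sahara_hat in x is ((x - d) + sqrt (\<beta>\<^sup>2 + (x - d)\<^sup>2)) powr (- \<alpha>) > 0, so
   strict_mono in place of mono would define the same class. *)
definition psahara :: "(real \<Rightarrow> real) \<Rightarrow> bool" where
  "psahara U \<longleftrightarrow>
     (\<exists>(n::nat) (a :: nat \<Rightarrow> ereal) (\<alpha> :: nat \<Rightarrow> real) (\<beta> :: nat \<Rightarrow> real)
        (d :: nat \<Rightarrow> real) (\<gamma> :: nat \<Rightarrow> real) (u :: nat \<Rightarrow> real).
        a 0 = - \<infinity> \<and> a (Suc n) = \<infinity> \<and> (\<forall>k\<le>n. a k < a (Suc k)) \<and>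
        (\<forall>k\<le>n. \<alpha> k \<ge> 0 \<and> \<beta> k > 0 \<and> \<gamma> k > 0) \<and>
        mono U \<and> continuous_on UNIV U \<and>
        (\<forall>k\<le>n. \<forall>x. a k < ereal x \<and> ereal x < a (Suc k) \<longrightarrow>
           U x = \<gamma> k * sahara_hat x (\<alpha> k) (\<beta> k) (d k) + u k))"

definition concave_majorants :: "(real \<Rightarrow> real) \<Rightarrow> (real \<Rightarrow> real) set" where
  "concave_majorants U =
     {h. concave_on UNIV h \<and> continuous_on UNIV h \<and> (\<forall>x. U x \<le> h x)}"

(* Only meaningful if concave_majorants U is nonempty: otherwise the envelope is +\<infinity> in the
   extended reals, whereas Inf {} is an unspecified real. *)
definition concave_envelope :: "(real \<Rightarrow> real) \<Rightarrow> real \<Rightarrow> real" where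
  "concave_envelope U x = Inf {h x |h. h \<in> concave_majorants U}"

end

theory Submission
  imports Defs
begin

text \<open>
  Let \<open>U\<close> be a PSAHARA utility with a concave majorant and \<open>E\<close> its concave envelope. Then \<open>E\<close> is
  concave, continuous, increasing and \<open>\<ge> U\<close>, so only the piecewise form of \<open>E\<close> is at stake. It is
  read off from the contact set \<open>{x. E x = U x}\<close>.

  Off the contact set \<open>E\<close> is locally affine: near a point with \<open>U < E\<close> a short chord of \<open>E\<close> still
  lies above \<open>U\<close>, so the minimum of \<open>E\<close> and the line through that chord is a concave majorant, and
  minimality of \<open>E\<close> makes it coincide with the chord (\<open>envelope_locally_affine\<close>). Hence \<open>E\<close> is
  affine on every open interval without contact points (\<open>envelope_affine_on\<close>).

  Each SAHARA function is concave, its derivative \<open>((x - d) + sqrt (\<beta>\<^sup>2 + (x - d)\<^sup>2)) powr (- \<alpha>)\<close>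
  being decreasing (\<open>sahara_hat_deriv\<close>, \<open>sahara_hat_concave\<close>). Therefore the contact points within
  one piece of \<open>U\<close> form an interval (\<open>contact_between\<close>), and the piece splits into at most three
  intervals: an outer one on either side, where \<open>E\<close> is affine, and a middle one, where
  \<open>E = U\<close> (\<open>envelope_chain_on_piece\<close>). This covers the two unbounded pieces as well, so the
  behaviour of \<open>U\<close> at \<open>\<plusminus>\<infinity>\<close> needs no separate treatment.

  An affine function of positive slope is, up to scaling and a constant, a SAHARA function with
  \<open>\<alpha> = 0\<close> (\<open>sahara_piece_line\<close>). That the affine parts of \<open>E\<close> do have positive slope follows from
  \<open>envelope_strict_mono\<close>.

  For the second claim, the identity lowered at one point is not monotone, but its envelope is
  the identity.
\<close>

section \<open>The SAHARA functions\<close>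

lemma sahara_base_pos:
  fixes y b :: real
  assumes "b > 0"
  shows "y + sqrt (b\<^sup>2 + y\<^sup>2) > 0"
proof -
  have "sqrt (y\<^sup>2) < sqrt (b\<^sup>2 + y\<^sup>2)"
    using assms by (intro real_sqrt_less_mono) simp
  then show ?thesis by simp
qed

lemma sahara_sqrt_deriv:
  fixes b d x :: real
  assumes "b > 0"
  shows "((\<lambda>x. sqrt (b\<^sup>2 + (x - d)\<^sup>2)) has_real_derivative
           (x - d) / sqrt (b\<^sup>2 + (x - d)\<^sup>2)) (at x)"
proof -
  have "b\<^sup>2 + (x - d)\<^sup>2 > 0" using assms by (simp add: pos_add_strict add_pos_nonneg)
  then show ?thesis
    by (auto intro!: derivative_eq_intros simp: divide_simps)
qed

lemma sahara_hat_deriv: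
  assumes "b > 0" "\<alpha> \<ge> 0"
  shows "((\<lambda>x. sahara_hat x \<alpha> b d) has_real_derivative
           ((x - d) + sqrt (b\<^sup>2 + (x - d)\<^sup>2)) powr (- \<alpha>)) (at x)"
proof -
  define s where "s = sqrt (b\<^sup>2 + (x - d)\<^sup>2)"
  define w where "w = (x - d) + s"
  have spos: "s > 0" unfolding s_def
    using assms by (simp add: add_pos_nonneg)
  have s2: "s\<^sup>2 = b\<^sup>2 + (x - d)\<^sup>2" unfolding s_def by simp
  have wpos: "w > 0" unfolding w_def s_def using sahara_base_pos[OF assms(1)] .
  have ds: "((\<lambda>x. sqrt (b\<^sup>2 + (x - d)\<^sup>2)) has_real_derivative (x - d) / s) (at x)"
    using sahara_sqrt_deriv[OF assms(1), of d x] by (simp add: s_def)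
  have dy: "((\<lambda>x. x - d) has_real_derivative 1) (at x)"
    by (auto intro!: derivative_eq_intros)
  have dw: "((\<lambda>x. (x - d) + sqrt (b\<^sup>2 + (x - d)\<^sup>2)) has_real_derivative w / s) (at x)"
    using DERIV_add[OF dy ds] spos by (simp add: w_def field_simps)
  show ?thesis
  proof (cases "\<alpha> = 1")
    case True
    have dln: "((\<lambda>x. ln ((x - d) + sqrt (b\<^sup>2 + (x - d)\<^sup>2))) has_real_derivative
         1 / w * (w / s)) (at x)"
      using DERIV_chain2[OF _ dw, of ln "1 / w"] DERIV_ln_divide[OF wpos]
      by (simp add: w_def s_def)
    have "((\<lambda>x. 1/2 * ln ((x - d) + sqrt (b\<^sup>2 + (x - d)\<^sup>2))
          + 1/2 * (1 / b\<^sup>2) * ((x - d) * (sqrt (b\<^sup>2 + (x - d)\<^sup>2) - (x - d))))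
        has_real_derivative 1/2 * (1 / w * (w / s))
          + 1/2 * (1 / b\<^sup>2) * (1 * (s - (x - d)) + ((x - d) / s - 1) * (x - d))) (at x)"
      using DERIV_add[OF DERIV_cmult[OF dln, of "1/2"]
        DERIV_cmult[OF DERIV_mult[OF dy DERIV_diff[OF ds dy]], of "1/2 * (1 / b\<^sup>2)"]]
      by (simp add: s_def)
    moreover have "1/2 * (1 / w * (w / s))
          + 1/2 * (1 / b\<^sup>2) * (1 * (s - (x - d)) + ((x - d) / s - 1) * (x - d)) = 1 / w"
    proof -
      define y where "y = x - d"
      have b2: "b\<^sup>2 = (s - y) * (s + y)" using s2 by (simp add: y_def power2_eq_square algebra_simps)
      have "s - y \<noteq> 0" "s + y \<noteq> 0" using b2 assms by auto
      then have "1/2 * (1 / s) + 1/2 * (1 / ((s - y) * (s + y))) * ((s - y) + (y / s - 1) * y)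
                 = 1 / (y + s)"
        using spos by (simp add: divide_simps) (simp add: algebra_simps power2_eq_square)
      then show ?thesis using wpos by (simp add: b2 w_def y_def[symmetric])
    qed
    ultimately show ?thesis
      using wpos True by (simp add: sahara_hat_def mult.assoc powr_minus_divide w_def s_def)
  next
    case False
    have dp: "((\<lambda>x. ((x - d) + sqrt (b\<^sup>2 + (x - d)\<^sup>2)) powr (- \<alpha>)) has_real_derivative
         (- \<alpha>) * w powr (- \<alpha>) / s) (at x)"
    proof (rule DERIV_cong[OF DERIV_fun_powr[OF dw]])
      show "0 < (x - d) + sqrt (b\<^sup>2 + (x - d)\<^sup>2)" using wpos by (simp add: w_def s_def)
      have "(x - d) + sqrt (b\<^sup>2 + (x - d)\<^sup>2) = w" by (simp add: w_def s_def)
      then show "- \<alpha> * ((x - d) + sqrt (b\<^sup>2 + (x - d)\<^sup>2)) powr (- \<alpha> - of_nat 1) * (w / s)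
          = (- \<alpha>) * w powr (- \<alpha>) / s"
        using wpos by (simp add: powr_diff)
    qed
    have "((\<lambda>x. - (1 / (\<alpha>\<^sup>2 - 1)) * (((x - d) + sqrt (b\<^sup>2 + (x - d)\<^sup>2)) powr (- \<alpha>)
        * ((x - d) + \<alpha> * sqrt (b\<^sup>2 + (x - d)\<^sup>2)))) has_real_derivative
        - (1 / (\<alpha>\<^sup>2 - 1)) * (((- \<alpha>) * w powr (- \<alpha>) / s) * ((x - d) + \<alpha> * s)
          + (1 + \<alpha> * ((x - d) / s)) * w powr (- \<alpha>))) (at x)"
      using DERIV_cmult[OF DERIV_mult[OF dp DERIV_add[OF dy DERIV_cmult[OF ds, of \<alpha>]]],
          of "- (1 / (\<alpha>\<^sup>2 - 1))"]
      by (simp add: s_def w_def)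
    moreover have "- (1 / (\<alpha>\<^sup>2 - 1)) * (((- \<alpha>) * P / s) * ((x - d) + \<alpha> * s)
          + (1 + \<alpha> * ((x - d) / s)) * P) = P" for P
    proof -
      \<comment> \<open>Nonnegativity of \<open>\<alpha>\<close> excludes \<open>\<alpha> = - 1\<close>.\<close>
      have "\<alpha>\<^sup>2 - 1 \<noteq> 0" using False \<open>\<alpha> \<ge> 0\<close> by (simp add: power2_eq_1_iff)
      moreover have "((- \<alpha>) * P / s) * ((x - d) + \<alpha> * s) + (1 + \<alpha> * ((x - d) / s)) * P
          = - ((\<alpha>\<^sup>2 - 1) * P)"
        using spos by (simp add: field_simps power2_eq_square)
      ultimately show ?thesis by simp
    qed
    ultimately show ?thesis
      using False by (simp add: sahara_hat_def mult.assoc w_def s_def)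
  qed
qed

lemma sahara_hat_concave:
  assumes "b > 0" "\<alpha> \<ge> 0"
  shows "concave_on UNIV (\<lambda>x. sahara_hat x \<alpha> b d)"
  unfolding concave_on_def
proof (rule convex_on_realI[where f' = "\<lambda>x. - (((x - d) + sqrt (b\<^sup>2 + (x - d)\<^sup>2)) powr (- \<alpha>))"])
  fix x :: real
  show "((\<lambda>x. - sahara_hat x \<alpha> b d) has_real_derivative
      - (((x - d) + sqrt (b\<^sup>2 + (x - d)\<^sup>2)) powr (- \<alpha>))) (at x)"
    using DERIV_minus[OF sahara_hat_deriv[OF assms]] .
next
  fix x y :: real
  assume "x \<le> y"
  have "(x - d) + sqrt (b\<^sup>2 + (x - d)\<^sup>2) \<le> (y - d) + sqrt (b\<^sup>2 + (y - d)\<^sup>2)"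
  proof (rule DERIV_nonneg_imp_nondecreasing[OF \<open>x \<le> y\<close>], intro exI conjI)
    fix t :: real
    show "((\<lambda>x. (x - d) + sqrt (b\<^sup>2 + (x - d)\<^sup>2)) has_real_derivative
        1 + (t - d) / sqrt (b\<^sup>2 + (t - d)\<^sup>2)) (at t)"
      using DERIV_add[OF DERIV_diff[OF DERIV_ident DERIV_const] sahara_sqrt_deriv[OF assms(1)]]
      by simp
    have "b\<^sup>2 + (t - d)\<^sup>2 > 0" using assms(1) by (simp add: add_pos_nonneg)
    then have "sqrt (b\<^sup>2 + (t - d)\<^sup>2) > 0" by (rule real_sqrt_gt_zero)
    moreover from this have "1 + (t - d) / sqrt (b\<^sup>2 + (t - d)\<^sup>2)
        = ((t - d) + sqrt (b\<^sup>2 + (t - d)\<^sup>2)) / sqrt (b\<^sup>2 + (t - d)\<^sup>2)"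
      using assms(1) by (simp add: add_divide_distrib)
    ultimately show "0 \<le> 1 + (t - d) / sqrt (b\<^sup>2 + (t - d)\<^sup>2)"
      using sahara_base_pos[OF assms(1), of "t - d"] by (metis divide_nonneg_pos less_imp_le)
  qed
  then show "- (((x - d) + sqrt (b\<^sup>2 + (x - d)\<^sup>2)) powr (- \<alpha>))
      \<le> - (((y - d) + sqrt (b\<^sup>2 + (y - d)\<^sup>2)) powr (- \<alpha>))"
    using sahara_base_pos[OF assms(1), of "x - d"] assms(2)
    by (simp add: powr_mono2')
qed simp

lemma sahara_hat_strict_mono:
  assumes "b > 0" "\<alpha> \<ge> 0" "x < y"
  shows "sahara_hat x \<alpha> b d < sahara_hat y \<alpha> b d"
proof (rule DERIV_pos_imp_increasing[OF \<open>x < y\<close>], intro exI conjI)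
  fix t :: real
  show "((\<lambda>x. sahara_hat x \<alpha> b d) has_real_derivative
      ((t - d) + sqrt (b\<^sup>2 + (t - d)\<^sup>2)) powr (- \<alpha>)) (at t)"
    by (rule sahara_hat_deriv[OF assms(1,2)])
  show "0 < ((t - d) + sqrt (b\<^sup>2 + (t - d)\<^sup>2)) powr (- \<alpha>)"
    using sahara_base_pos[OF assms(1), of "t - d"] by simp
qed

lemma sahara_hat_linear: "sahara_hat x 0 1 0 = x"
  using sahara_base_pos[of 1 x] by (simp add: sahara_hat_def)

section \<open>Concave functions on the line\<close>

lemma concave_on_line: "concave_on UNIV (\<lambda>x::real. s * x + c)"
  unfolding concave_on_iff
proof (intro conjI ballI allI impI)
  fix x y u v :: real
  assume "u + v = 1"
  then have "u * c + v * c = c" by (metis distrib_right mult_1)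
  then show "u * (s * x + c) + v * (s * y + c) \<le> s * (u *\<^sub>R x + v *\<^sub>R y) + c"
    by (simp add: algebra_simps)
qed simp

lemma concave_on_min:
  assumes "concave_on S f" "concave_on S g"
  shows "concave_on S (\<lambda>x. min (f x) (g x))"
  unfolding concave_on_iff
proof (intro conjI ballI allI impI)
  show "convex S" using assms(1) by (rule concave_on_imp_convex)
  fix x y and u v :: real
  assume *: "x \<in> S" "y \<in> S" "0 \<le> u" "0 \<le> v" "u + v = 1"
  let ?m = "u * min (f x) (g x) + v * min (f y) (g y)"
  have "?m \<le> u * f x + v * f y" "?m \<le> u * g x + v * g y"
    using * by (intro add_mono mult_left_mono; simp)+
  moreover have "u * f x + v * f y \<le> f (u *\<^sub>R x + v *\<^sub>R y)"
      "u * g x + v * g y \<le> g (u *\<^sub>R x + v *\<^sub>R y)"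
    using assms * unfolding concave_on_iff by blast+
  ultimately show "?m \<le> min (f (u *\<^sub>R x + v *\<^sub>R y)) (g (u *\<^sub>R x + v *\<^sub>R y))" by linarith
qed

text \<open>The affine function that agrees with \<open>f\<close> at \<open>p\<close> and \<open>q\<close>, on the whole line. Its defining form
  is slope times \<open>x\<close> plus constant, which makes it an instance of \<open>concave_on_line\<close>.\<close>

definition chord :: "(real \<Rightarrow> real) \<Rightarrow> real \<Rightarrow> real \<Rightarrow> real \<Rightarrow> real" where
  "chord f p q x = (f q - f p) / (q - p) * x + (f p - (f q - f p) / (q - p) * p)"

lemma chord_altdef: "chord f p q x = (f q - f p) / (q - p) * (x - p) + f p"
  unfolding chord_def right_diff_distrib by linarith

lemma concave_ge_chord:
  assumes "concave_on S f" "p \<in> S" "q \<in> S" "p < q" "p \<le> x" "x \<le> q"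
  shows "chord f p q x \<le> f x"
proof -
  have "{p..q} \<subseteq> S"
    using concave_on_imp_convex[OF assms(1)] assms(2,3)
    by (metis closed_segment_eq_real_ivl1 closed_segment_subset assms(4) less_imp_le)
  then have "concave_on {p..q} f"
    using assms(1) by (auto simp: concave_on_iff subset_iff)
  from concave_onD_Icc'[OF this, of x] assms show ?thesis by (simp add: chord_altdef)
qed

lemma concave_le_chord:
  assumes "concave_on S f" "p \<in> S" "q \<in> S" "x \<in> S" "p < q" "x \<le> p \<or> q \<le> x"
  shows "f x \<le> chord f p q x"
  using assms(6)
proof
  assume "x \<le> p"
  show ?thesis
  proof (cases "x = p")
    case False
    then have "chord f x q p \<le> f p"
      using assms \<open>x \<le> p\<close> by (intro concave_ge_chord[OF assms(1)]) auto
    then have "(f q - f x) * (p - x) + f x * (q - x) \<le> f p * (q - x)"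
      using \<open>x \<le> p\<close> False assms(5) by (simp add: chord_altdef field_simps)
    then have "f x * (q - p) \<le> (f q - f p) * (x - p) + f p * (q - p)"
      by (simp add: algebra_simps)
    then show ?thesis using assms(5) by (simp add: chord_altdef field_simps)
  qed (simp add: chord_altdef)
next
  assume "q \<le> x"
  show ?thesis
  proof (cases "x = q")
    case False
    then have "chord f p x q \<le> f q"
      using assms \<open>q \<le> x\<close> by (intro concave_ge_chord[OF assms(1)]) auto
    then have "(f x - f p) * (q - p) + f p * (x - p) \<le> f q * (x - p)"
      using \<open>q \<le> x\<close> False assms(5) by (simp add: chord_altdef field_simps)
    then have "f x * (q - p) \<le> (f q - f p) * (x - p) + f p * (q - p)"
      by (simp add: algebra_simps)
    then show ?thesis using assms(5) by (simp add: chord_altdef field_simps)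
  qed (use assms(5) in \<open>simp add: chord_altdef\<close>)
qed

lemma locally_affine_imp_affine:
  fixes f :: "real \<Rightarrow> real"
  assumes S: "open S" "convex S"
    and loc: "\<And>x. x \<in> S \<Longrightarrow> \<exists>p q s c. p < x \<and> x < q \<and> (\<forall>y\<in>{p<..<q}. f y = s * y + c)"
  shows "\<exists>s c. \<forall>x\<in>S. f x = s * x + c"
proof -
  have f': "\<exists>p q s. p < x \<and> x < q \<and> (\<forall>y\<in>{p<..<q}. (f has_real_derivative s) (at y))"
    if x: "x \<in> S" for x
  proof -
    obtain p q s c where pq: "p < x" "x < q" and eq: "\<And>y. y \<in> {p<..<q} \<Longrightarrow> f y = s * y + c"
      using loc[OF x] by blast
    have "(f has_real_derivative s) (at y)" if "y \<in> {p<..<q}" for y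
      by (rule has_field_derivative_transform_within_open[where S = "{p<..<q}"
            and f = "\<lambda>y. s * y + c"])
         (use that eq in \<open>auto intro!: derivative_eq_intros\<close>)
    then show ?thesis using pq by blast
  qed
  have "(deriv f has_field_derivative 0) (at x within S)" if x: "x \<in> S" for x
  proof -
    obtain p q s where pq: "p < x" "x < q"
      and d: "\<And>y. y \<in> {p<..<q} \<Longrightarrow> (f has_real_derivative s) (at y)"
      using f'[OF x] by blast
    have "(deriv f has_real_derivative 0) (at x)"
      by (rule has_field_derivative_transform_within_open[where S = "{p<..<q}" and f = "\<lambda>y. s"])
         (use pq DERIV_imp_deriv[OF d] in auto)
    then show ?thesis by (rule has_field_derivative_at_within)
  qed
  then obtain s where s: "\<And>x. x \<in> S \<Longrightarrow> deriv f x = s"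
    using has_field_derivative_zero_constant[OF S(2)] by metis
  have "((\<lambda>x. f x - s * x) has_field_derivative 0) (at x within S)" if x: "x \<in> S" for x
  proof -
    have "(f has_real_derivative s) (at x)"
      using f'[OF x] s[OF x] DERIV_imp_deriv by force
    then have "((\<lambda>x. f x - s * x) has_real_derivative 0) (at x)"
      by (auto intro!: derivative_eq_intros)
    then show ?thesis by (rule has_field_derivative_at_within)
  qed
  then obtain c where "\<And>x. x \<in> S \<Longrightarrow> f x - s * x = c"
    using has_field_derivative_zero_constant[OF S(2), of "\<lambda>x. f x - s * x"] by metis
  then have "\<forall>x\<in>S. f x = s * x + c" by (metis add.commute diff_add_cancel)
  then show ?thesis by blast
qed

section \<open>The concave envelope\<close>

lemma envelope_bdd_below: "bdd_below {h x |h. h \<in> concave_majorants U}"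
  by (rule bdd_belowI[of _ "U x"]) (auto simp: concave_majorants_def)

lemma envelope_le:
  assumes "h \<in> concave_majorants U"
  shows "concave_envelope U x \<le> h x"
  unfolding concave_envelope_def
  by (rule cInf_lower[OF _ envelope_bdd_below]) (use assms in blast)

lemma envelope_greatest:
  assumes "concave_majorants U \<noteq> {}" "\<And>h. h \<in> concave_majorants U \<Longrightarrow> c \<le> h x"
  shows "c \<le> concave_envelope U x"
  unfolding concave_envelope_def by (rule cInf_greatest) (use assms in auto)

lemma envelope_concave:
  assumes "concave_majorants U \<noteq> {}"
  shows "concave_on UNIV (concave_envelope U)"
  unfolding concave_on_iff
proof (intro conjI ballI allI impI)
  fix x y u v :: real
  assume *: "0 \<le> u" "0 \<le> v" "u + v = 1"
  show "u * concave_envelope U x + v * concave_envelope U y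
      \<le> concave_envelope U (u *\<^sub>R x + v *\<^sub>R y)"
  proof (rule envelope_greatest[OF assms])
    fix h assume h: "h \<in> concave_majorants U"
    have "u * concave_envelope U x + v * concave_envelope U y \<le> u * h x + v * h y"
      using * by (intro add_mono mult_left_mono envelope_le[OF h]) auto
    also have "\<dots> \<le> h (u *\<^sub>R x + v *\<^sub>R y)"
      using h * by (auto simp: concave_majorants_def concave_on_iff)
    finally show "u * concave_envelope U x + v * concave_envelope U y \<le> h (u *\<^sub>R x + v *\<^sub>R y)" .
  qed
qed simp

lemma envelope_continuous:
  assumes "concave_majorants U \<noteq> {}"
  shows "continuous_on UNIV (concave_envelope U)"
proof -
  have "continuous_on UNIV (\<lambda>x. - concave_envelope U x)"
    using envelope_concave[OF assms] by (intro convex_on_continuous) (auto simp: concave_on_def)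
  from continuous_on_minus[OF this] show ?thesis by simp
qed

lemma envelope_ge:
  assumes "concave_majorants U \<noteq> {}"
  shows "U x \<le> concave_envelope U x"
  by (rule envelope_greatest[OF assms]) (auto simp: concave_majorants_def)

text \<open>Monotonicity is inherited because shifting a majorant of an increasing function to the
  left gives another majorant.\<close>

lemma envelope_mono:
  assumes "concave_majorants U \<noteq> {}" "mono U"
  shows "mono (concave_envelope U)"
proof (rule monoI)
  fix x y :: real
  assume "x \<le> y"
  show "concave_envelope U x \<le> concave_envelope U y"
  proof (rule envelope_greatest[OF assms(1)])
    fix h assume h: "h \<in> concave_majorants U"
    define g where "g t = h (t + (y - x))" for t
    have "concave_on UNIV g"
      unfolding concave_on_iff
    proof (intro conjI ballI allI impI)
      fix a b u v :: real
      assume *: "0 \<le> u" "0 \<le> v" "u + v = 1"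
      have "u * (y - x) + v * (y - x) = y - x" using *(3) by (metis distrib_right mult_1)
      then have "(u *\<^sub>R a + v *\<^sub>R b) + (y - x) = u *\<^sub>R (a + (y - x)) + v *\<^sub>R (b + (y - x))"
        by (simp add: algebra_simps)
      then show "u * g a + v * g b \<le> g (u *\<^sub>R a + v *\<^sub>R b)"
        using h * by (auto simp: g_def concave_majorants_def concave_on_iff)
    qed simp
    moreover have "continuous_on UNIV g"
      using h unfolding g_def concave_majorants_def
      by (auto intro!: continuous_on_compose2[of UNIV h] continuous_intros)
    moreover have "U t \<le> g t" for t
    proof -
      have "U t \<le> U (t + (y - x))" using assms(2) \<open>x \<le> y\<close> by (simp add: monoD)
      also have "\<dots> \<le> g t" using h by (auto simp: g_def concave_majorants_def)
      finally show ?thesis .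
    qed
    ultimately have "g \<in> concave_majorants U" by (simp add: concave_majorants_def)
    from envelope_le[OF this, of x] show "concave_envelope U x \<le> h y" by (simp add: g_def)
  qed
qed

lemma envelope_locally_affine:
  assumes ne: "concave_majorants U \<noteq> {}" and cont: "continuous_on UNIV U"
    and z: "U z < concave_envelope U z"
  shows "\<exists>p q s c. p < z \<and> z < q \<and> (\<forall>y\<in>{p<..<q}. concave_envelope U y = s * y + c)"
proof -
  let ?E = "concave_envelope U"
  obtain m where m: "U z < m" "m < ?E z" using z dense by blast
  have "isCont U z" "isCont ?E z"
    using cont envelope_continuous[OF ne] by (simp_all add: continuous_on_eq_continuous_at)
  then have "(U \<longlongrightarrow> U z) (nhds z)" "(?E \<longlongrightarrow> ?E z) (nhds z)"
    by (simp_all add: isCont_def tendsto_at_iff_tendsto_nhds)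
  then have "\<forall>\<^sub>F y in nhds z. U y < m" "\<forall>\<^sub>F y in nhds z. m < ?E y"
    using m by (auto intro: order_tendstoD)
  then have "\<forall>\<^sub>F y in nhds z. U y < m \<and> m < ?E y" by (rule eventually_conj)
  then obtain e where e: "e > 0" "\<And>y. dist y z < e \<Longrightarrow> U y < m \<and> m < ?E y"
    by (auto simp: eventually_nhds_metric)
  define p q where "p = z - e / 2" and "q = z + e / 2"
  have pq: "p < z" "z < q" "p < q" using e(1) by (auto simp: p_def q_def)
  have near: "U y < m" "m < ?E y" if "y \<in> {p..q}" for y
    using e(2)[of y] that e(1) by (auto simp: p_def q_def dist_real_def)
  note conc = envelope_concave[OF ne]
  have above: "m \<le> chord ?E p q y" if y: "y \<in> {p..q}" for y
  proof -
    define t where "t = (y - p) / (q - p)"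
    have t: "0 \<le> t" "t \<le> 1" using y pq by (auto simp: t_def)
    \<comment> \<open>The chord is a convex combination of two values above \<open>m\<close>.\<close>
    have "chord ?E p q y = (?E q - ?E p) * t + ?E p" by (simp add: chord_altdef t_def)
    then have "chord ?E p q y = (1 - t) * ?E p + t * ?E q" by (simp add: algebra_simps)
    moreover have "(1 - t) * m + t * m \<le> (1 - t) * ?E p + t * ?E q"
      using t near(2)[of p] near(2)[of q] pq by (intro add_mono mult_left_mono) auto
    moreover have "(1 - t) * m + t * m = m" by (simp add: algebra_simps)
    ultimately show ?thesis by linarith
  qed
  have "(\<lambda>y. min (?E y) (chord ?E p q y)) \<in> concave_majorants U"
    unfolding concave_majorants_def
  proof (intro CollectI conjI allI)
    show "concave_on UNIV (\<lambda>y. min (?E y) (chord ?E p q y))"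
      unfolding chord_def by (intro concave_on_min conc concave_on_line)
    show "continuous_on UNIV (\<lambda>y. min (?E y) (chord ?E p q y))"
      unfolding chord_def by (intro continuous_intros envelope_continuous[OF ne])
    fix y
    show "U y \<le> min (?E y) (chord ?E p q y)"
    proof (cases "y \<in> {p..q}")
      case True
      then show ?thesis using near[OF True] above[OF True] by auto
    next
      case False
      then have "?E y \<le> chord ?E p q y"
        using pq by (intro concave_le_chord[OF conc]) auto
      then show ?thesis using envelope_ge[OF ne, of y] by auto
    qed
  qed
  from envelope_le[OF this] have "?E y \<le> chord ?E p q y" for y by simp
  moreover have "chord ?E p q y \<le> ?E y" if "y \<in> {p<..<q}" for y
    using that pq by (intro concave_ge_chord[OF conc]) auto
  ultimately have "?E y = chord ?E p q y" if "y \<in> {p<..<q}" for y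
    using that by (simp add: antisym)
  then have "\<forall>y\<in>{p<..<q}. ?E y = (?E q - ?E p) / (q - p) * y
      + (?E p - (?E q - ?E p) / (q - p) * p)"
    by (simp only: chord_def) blast
  then show ?thesis using pq by blast
qed

lemma envelope_affine_on:
  assumes "concave_majorants U \<noteq> {}" "continuous_on UNIV U" "open S" "convex S"
    and "\<And>x. x \<in> S \<Longrightarrow> concave_envelope U x \<noteq> U x"
  shows "\<exists>s c. \<forall>x\<in>S. concave_envelope U x = s * x + c"
proof (rule locally_affine_imp_affine[OF assms(3,4)])
  fix x assume "x \<in> S"
  then have "U x < concave_envelope U x"
    using assms(5)[of x] envelope_ge[OF assms(1), of x] by simp
  then show "\<exists>p q s c. p < x \<and> x < q \<and> (\<forall>y\<in>{p<..<q}. concave_envelope U y = s * y + c)"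
    by (rule envelope_locally_affine[OF assms(1,2)])
qed

section \<open>Chains of SAHARA pieces\<close>

text \<open>\<open>f\<close> is given by a single parameter set on the open interval \<open>(l, r)\<close>.\<close>

definition sahara_piece :: "(real \<Rightarrow> real) \<Rightarrow> ereal \<Rightarrow> ereal \<Rightarrow> bool" where
  "sahara_piece f l r \<longleftrightarrow> (\<exists>\<alpha> \<beta> d \<gamma> u. \<alpha> \<ge> 0 \<and> \<beta> > 0 \<and> \<gamma> > 0 \<and>
     (\<forall>x. l < ereal x \<and> ereal x < r \<longrightarrow> f x = \<gamma> * sahara_hat x \<alpha> \<beta> d + u))"

text \<open>\<open>(l, r)\<close> splits, up to finitely many breakpoints, into intervals that carry a single
  SAHARA piece of \<open>f\<close> each. Nothing is required at the breakpoints.\<close>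

definition sahara_chain :: "(real \<Rightarrow> real) \<Rightarrow> ereal \<Rightarrow> ereal \<Rightarrow> bool" where
  "sahara_chain f l r \<longleftrightarrow> (\<exists>(n::nat) a. a 0 = l \<and> a (Suc n) = r \<and>
     (\<forall>k\<le>n. a k < a (Suc k) \<and> sahara_piece f (a k) (a (Suc k))))"

lemma psahara_iff_chain:
  "psahara f \<longleftrightarrow> mono f \<and> continuous_on UNIV f \<and> sahara_chain f (- \<infinity>) \<infinity>"
proof
  assume "psahara f"
  then show "mono f \<and> continuous_on UNIV f \<and> sahara_chain f (- \<infinity>) \<infinity>"
    unfolding psahara_def
  proof (elim exE conjE)
    fix n and a :: "nat \<Rightarrow> ereal" and \<alpha> \<beta> d \<gamma> u
    assume a: "a 0 = - \<infinity>" "a (Suc n) = \<infinity>" "\<forall>k\<le>n. a k < a (Suc k)"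
      and par: "\<forall>k\<le>n. 0 \<le> \<alpha> k \<and> 0 < \<beta> k \<and> 0 < \<gamma> k"
      and f: "mono f" "continuous_on UNIV f"
      and eq: "\<forall>k\<le>n. \<forall>x. a k < ereal x \<and> ereal x < a (Suc k) \<longrightarrow>
        f x = \<gamma> k * sahara_hat x (\<alpha> k) (\<beta> k) (d k) + u k"
    have "sahara_piece f (a k) (a (Suc k))" if "k \<le> n" for k
      unfolding sahara_piece_def
      by (rule exI[of _ "\<alpha> k"], rule exI[of _ "\<beta> k"], rule exI[of _ "d k"],
          rule exI[of _ "\<gamma> k"], rule exI[of _ "u k"])
         (intro conjI, use par that in simp_all, use eq that in blast)
    then have "sahara_chain f (- \<infinity>) \<infinity>"
      unfolding sahara_chain_def using a by (intro exI[of _ n] exI[of _ a]) simp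
    then show ?thesis using f by simp
  qed
next
  assume *: "mono f \<and> continuous_on UNIV f \<and> sahara_chain f (- \<infinity>) \<infinity>"
  then obtain n and a :: "nat \<Rightarrow> ereal" where a: "a 0 = - \<infinity>" "a (Suc n) = \<infinity>"
      "\<forall>k\<le>n. a k < a (Suc k)" and p: "\<forall>k\<le>n. sahara_piece f (a k) (a (Suc k))"
    unfolding sahara_chain_def by blast
  define P where "P k v \<longleftrightarrow> (case v of (\<alpha>, \<beta>, d, \<gamma>, u) \<Rightarrow> 0 \<le> \<alpha> \<and> 0 < \<beta> \<and> 0 < \<gamma> \<and>
     (\<forall>x. a k < ereal x \<and> ereal x < a (Suc k) \<longrightarrow> f x = \<gamma> * sahara_hat x \<alpha> \<beta> d + u))"
    for k and v :: "real \<times> real \<times> real \<times> real \<times> real"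
  define v where "v k = (SOME v. P k v)" for k
  have v: "P k (v k)" if "k \<le> n" for k
  proof -
    have "\<exists>v. P k v" using p that by (simp add: sahara_piece_def P_def)
    then show ?thesis unfolding v_def by (rule someI_ex)
  qed
  show "psahara f"
    unfolding psahara_def
    by (rule exI[of _ n], rule exI[of _ a], rule exI[of _ "\<lambda>k. fst (v k)"],
        rule exI[of _ "\<lambda>k. fst (snd (v k))"], rule exI[of _ "\<lambda>k. fst (snd (snd (v k)))"],
        rule exI[of _ "\<lambda>k. fst (snd (snd (snd (v k))))"],
        rule exI[of _ "\<lambda>k. snd (snd (snd (snd (v k))))"])
       (use a * v in \<open>simp add: P_def split_beta\<close>)
qed

lemma sahara_chain_piece:
  assumes "l < r" "sahara_piece f l r"
  shows "sahara_chain f l r"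
  unfolding sahara_chain_def
  by (rule exI[of _ 0], rule exI[of _ "\<lambda>k. if k = 0 then l else r"]) (use assms in auto)

lemma sahara_chain_join:
  assumes "sahara_chain f l m" "sahara_chain f m r"
  shows "sahara_chain f l r"
proof -
  obtain n a where a: "a 0 = l" "a (Suc n) = m"
      "\<And>k. k \<le> n \<Longrightarrow> a k < a (Suc k) \<and> sahara_piece f (a k) (a (Suc k))"
    using assms(1) unfolding sahara_chain_def by blast
  obtain n' a' where a': "a' 0 = m" "a' (Suc n') = r"
      "\<And>k. k \<le> n' \<Longrightarrow> a' k < a' (Suc k) \<and> sahara_piece f (a' k) (a' (Suc k))"
    using assms(2) unfolding sahara_chain_def by blast
  define b where "b k = (if k \<le> n then a k else a' (k - Suc n))" for k
  have "b k < b (Suc k) \<and> sahara_piece f (b k) (b (Suc k))" if "k \<le> Suc (n + n')" for k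
  proof -
    consider "k < n" | "k = n" | "k > n" by linarith
    then show ?thesis
    proof cases
      case 1
      then show ?thesis using a(3)[of k] by (simp add: b_def)
    next
      case 2
      then show ?thesis using a(2) a(3)[of n] a'(1) by (simp add: b_def)
    next
      case 3
      then have "Suc k - Suc n = Suc (k - Suc n)" "k - Suc n \<le> n'" using that by auto
      then show ?thesis using 3 a'(3)[of "k - Suc n"] by (simp add: b_def)
    qed
  qed
  moreover have "b 0 = l" "b (Suc (Suc (n + n'))) = r"
    using a(1) a'(2) by (simp_all add: b_def Suc_diff_le)
  ultimately show ?thesis unfolding sahara_chain_def by blast
qed

text \<open>A variant in which either part may be empty.\<close>

lemma sahara_chain_join_le:
  assumes "l \<le> m" "m \<le> r" "l < r" "l < m \<Longrightarrow> sahara_chain f l m" "m < r \<Longrightarrow> sahara_chain f m r"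
  shows "sahara_chain f l r"
proof (cases "l = m \<or> m = r")
  case True
  then show ?thesis using assms by auto
next
  case False
  then show ?thesis using assms by (intro sahara_chain_join[of f l m r]) auto
qed

lemma sahara_piece_line:
  assumes "s > 0" "\<And>x. l < ereal x \<Longrightarrow> ereal x < r \<Longrightarrow> f x = s * x + c"
  shows "sahara_piece f l r"
  unfolding sahara_piece_def
  by (rule exI[of _ 0], rule exI[of _ 1], rule exI[of _ 0], rule exI[of _ s], rule exI[of _ c])
     (use assms in \<open>simp add: sahara_hat_linear\<close>)

lemma open_ereal_interval: "open {x. l < ereal x \<and> ereal x < r}"
proof -
  have "open (ereal -` {l<..<r})"
    by (intro open_vimage continuous_on_ereal continuous_on_id) simp
  moreover have "ereal -` {l<..<r} = {x. l < ereal x \<and> ereal x < r}" by auto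
  ultimately show ?thesis by simp
qed

lemma convex_ereal_interval: "convex {x. l < ereal x \<and> ereal x < r}"
proof -
  have "is_interval {x. l < ereal x \<and> ereal x < r}"
    unfolding is_interval_1
  proof (intro ballI allI impI)
    fix a b x
    assume "a \<in> {x. l < ereal x \<and> ereal x < r}" "b \<in> {x. l < ereal x \<and> ereal x < r}"
      and "a \<le> x \<and> x \<le> b"
    then have "l < ereal a" "ereal a \<le> ereal x" and "ereal x \<le> ereal b" "ereal b < r"
      by simp_all
    then have "l < ereal x" and "ereal x < r"
      using less_le_trans[of l "ereal a"] le_less_trans[of "ereal x" "ereal b"] by blast+
    then show "x \<in> {x. l < ereal x \<and> ereal x < r}" by simp
  qed
  then show ?thesis by (simp add: is_interval_convex_1)
qed

lemma sahara_form_concave: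
  assumes "b > 0" "\<alpha> \<ge> 0" "\<gamma> > 0"
  shows "concave_on UNIV (\<lambda>x. \<gamma> * sahara_hat x \<alpha> b d + u)"
proof (rule concave_on_add)
  show "concave_on UNIV (\<lambda>x. \<gamma> * sahara_hat x \<alpha> b d)"
    using assms(3) by (intro concave_on_cmul[OF _ sahara_hat_concave[OF assms(1,2)]]) simp
qed (simp add: concave_on_const)

section \<open>The envelope of a PSAHARA utility\<close>

lemma psahara_no_max:
  assumes "psahara U"
  shows "\<exists>t. U z < U t"
proof -
  have mono: "mono U" using assms unfolding psahara_iff_chain by blast
  obtain n and a :: "nat \<Rightarrow> ereal" where last: "a (Suc n) = \<infinity>"
      and all: "\<And>k. k \<le> n \<Longrightarrow> a k < a (Suc k) \<and> sahara_piece U (a k) (a (Suc k))"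
    using assms unfolding psahara_iff_chain sahara_chain_def by blast
  have a: "a (Suc n) = \<infinity>" "a n < a (Suc n)" and p: "sahara_piece U (a n) (a (Suc n))"
    using last all[OF order_refl] by simp_all
  obtain \<alpha> \<beta> d \<gamma> u where par: "\<alpha> \<ge> 0" "\<beta> > 0" "\<gamma> > 0"
      and U: "\<And>x. a n < ereal x \<Longrightarrow> U x = \<gamma> * sahara_hat x \<alpha> \<beta> d + u"
    using p unfolding sahara_piece_def by (auto simp: a(1))
  obtain y where y: "a n < ereal y" using ereal_dense2[OF a(2)] by blast
  define t where "t = max y z"
  have t: "a n < ereal t" "a n < ereal (t + 1)"
    using less_le_trans[OF y, of "ereal t"] less_le_trans[OF y, of "ereal (t + 1)"]
    by (simp_all add: t_def)
  have "U z \<le> U t" using mono by (simp add: t_def monoD)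
  also have "U t < U (t + 1)"
    using U[OF t(1)] U[OF t(2)] sahara_hat_strict_mono[OF par(2,1), of t "t + 1" d] par(3)
    by simp
  finally show ?thesis by blast
qed

text \<open>The first piece is concave and strictly increasing as a function on the whole line, so to the
  left of \<open>0\<close> it lies below the line through its values at \<open>0\<close> and \<open>1\<close>.\<close>

lemma psahara_le_line_at_bot:
  assumes "psahara U"
  shows "\<exists>r s c. s > 0 \<and> (\<forall>x\<le>r. U x \<le> s * x + c)"
proof -
  obtain n and a :: "nat \<Rightarrow> ereal" where first: "a 0 = - \<infinity>"
      and all: "\<And>k. k \<le> n \<Longrightarrow> a k < a (Suc k) \<and> sahara_piece U (a k) (a (Suc k))"
    using assms unfolding psahara_iff_chain sahara_chain_def by blast
  have a: "a 0 = - \<infinity>" "a 0 < a (Suc 0)" and p: "sahara_piece U (a 0) (a (Suc 0))"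
    using first all[OF le0] by simp_all
  obtain \<alpha> \<beta> d \<gamma> u where par: "\<alpha> \<ge> 0" "\<beta> > 0" "\<gamma> > 0"
      and U: "\<And>x. ereal x < a (Suc 0) \<Longrightarrow> U x = \<gamma> * sahara_hat x \<alpha> \<beta> d + u"
    using p unfolding sahara_piece_def by (auto simp: a(1))
  define G where "G x = \<gamma> * sahara_hat x \<alpha> \<beta> d + u" for x
  have G: "concave_on UNIV G" unfolding G_def using par by (intro sahara_form_concave)
  have "G 0 < G 1" using sahara_hat_strict_mono[OF par(2,1), of 0 1 d] par(3) by (simp add: G_def)
  obtain y where y: "ereal y < a (Suc 0)" using ereal_dense2[OF a(2)] by blast
  have "U x \<le> (G 1 - G 0) * x + G 0" if "x \<le> min y 0" for x
  proof -
    have "ereal x < a (Suc 0)" using le_less_trans[OF _ y, of "ereal x"] that by simp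
    then have "U x = G x" unfolding G_def by (rule U)
    also have "\<dots> \<le> chord G 0 1 x" using that by (intro concave_le_chord[OF G]) auto
    finally show ?thesis by (simp add: chord_def)
  qed
  then show ?thesis using \<open>G 0 < G 1\<close>
    by (intro exI[of _ "min y 0"] exI[of _ "G 1 - G 0"] exI[of _ "G 0"]) auto
qed

text \<open>The envelope has no flat part. A flat part would sit at the maximum \<open>c\<close> of the envelope,
  which \<open>U\<close> does not attain, so the envelope is affine, and therefore constant, around each
  point where it takes the value \<open>c\<close>. By connectedness it would be constant on the whole line,
  contradicting the majorant of \<open>U\<close> that follows a line of positive slope near \<open>-\<infinity>\<close>.\<close>

lemma envelope_strict_mono:
  assumes ps: "psahara U" and ne: "concave_majorants U \<noteq> {}" and "x < y"
  shows "concave_envelope U x < concave_envelope U y"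
proof (rule ccontr)
  let ?E = "concave_envelope U"
  define c where "c = ?E x"
  have monoU: "mono U" and contU: "continuous_on UNIV U"
    using ps unfolding psahara_iff_chain by auto
  note mono = envelope_mono[OF ne monoU] and conc = envelope_concave[OF ne]
  assume "\<not> ?E x < ?E y"
  then have Ey: "?E y = c" using monoD[OF mono, of x y] \<open>x < y\<close> by (simp add: c_def)
  have le_c: "?E t \<le> c" for t
  proof (cases "y \<le> t")
    case True
    then have "?E t \<le> chord ?E x y t" using \<open>x < y\<close> by (intro concave_le_chord[OF conc]) auto
    then show ?thesis using Ey by (simp add: chord_def c_def)
  next
    case False
    then show ?thesis using monoD[OF mono, of t y] Ey by simp
  qed
  have U_less: "U t < c" for t
    using psahara_no_max[OF ps, of t] envelope_ge[OF ne] le_c by (meson less_le_trans order_trans)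
  let ?T = "{t. ?E t = c}"
  have "closed ?T"
    by (intro closed_Collect_eq envelope_continuous[OF ne] continuous_intros)
  moreover have "open ?T"
  proof (subst open_subopen, intro ballI)
    fix t assume "t \<in> ?T"
    then have Et: "?E t = c" by simp
    then obtain p q s k where pq: "p < t" "t < q"
        and aff: "\<And>v. v \<in> {p<..<q} \<Longrightarrow> ?E v = s * v + k"
      using envelope_locally_affine[OF ne contU, of t] U_less[of t] by auto
    define v where "v = (t + q) / 2"
    have v: "t < v" "v < q" using pq by (auto simp: v_def)
    have "?E v = c" using monoD[OF mono, of t v] le_c[of v] v Et by simp
    then have "s * v = s * t" using aff[of v] aff[of t] Et pq v by simp
    then have "s = 0" using v by simp
    then have "?E w = c" if "w \<in> {p<..<q}" for w using aff[OF that] aff[of t] pq Et by simp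
    then have "{p<..<q} \<subseteq> ?T" by blast
    then show "\<exists>B. open B \<and> t \<in> B \<and> B \<subseteq> ?T" using pq by (intro exI[of _ "{p<..<q}"]) auto
  qed
  ultimately have "?T = UNIV" using clopen[of ?T] by (auto simp: c_def)
  then have const: "?E t = c" for t by blast
  obtain r s k where s: "s > 0" and line: "\<And>x. x \<le> r \<Longrightarrow> U x \<le> s * x + k"
    using psahara_le_line_at_bot[OF ps] by blast
  \<comment> \<open>The line is raised so that it exceeds \<open>c\<close> to the right of \<open>r\<close>.\<close>
  define K where "K = k + \<bar>c - (s * r + k)\<bar>"
  have "(\<lambda>x. min c (s * x + K)) \<in> concave_majorants U"
    unfolding concave_majorants_def
  proof (intro CollectI conjI allI)
    show "concave_on UNIV (\<lambda>x. min c (s * x + K))"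
      by (intro concave_on_min concave_on_line) (simp add: concave_on_const)
    show "continuous_on UNIV (\<lambda>x. min c (s * x + K))" by (intro continuous_intros)
    fix x
    have "U x \<le> s * x + K"
    proof (cases "x \<le> r")
      case True
      then show ?thesis using line[of x] by (simp add: K_def)
    next
      case False
      then have "s * r \<le> s * x" using s by simp
      then show ?thesis using U_less[of x] by (simp add: K_def)
    qed
    then show "U x \<le> min c (s * x + K)" using U_less[of x] by simp
  qed
  \<comment> \<open>At this point the line has the value \<open>c - 1\<close>.\<close>
  from envelope_le[OF this, of "(c - K - 1) / s"] s show False by (simp add: const)
qed

lemma envelope_piece_without_contact:
  assumes ps: "psahara U" and ne: "concave_majorants U \<noteq> {}"
    and nc: "\<And>x. l < ereal x \<Longrightarrow> ereal x < r \<Longrightarrow> concave_envelope U x \<noteq> U x" and "l < r"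
  shows "sahara_piece (concave_envelope U) l r"
proof -
  have "continuous_on UNIV U" using ps unfolding psahara_iff_chain by auto
  from envelope_affine_on[OF ne this open_ereal_interval[of l r] convex_ereal_interval[of l r]] nc
  obtain s c where aff: "\<And>x. l < ereal x \<Longrightarrow> ereal x < r \<Longrightarrow> concave_envelope U x = s * x + c"
    by auto
  obtain x where x: "l < ereal x" "ereal x < r" using ereal_dense2[OF \<open>l < r\<close>] by blast
  obtain y where y: "ereal x < ereal y" "ereal y < r" using ereal_dense2[OF x(2)] by blast
  then have xy: "x < y" by simp
  have "s * x + c < s * y + c"
    using envelope_strict_mono[OF ps ne xy] aff[OF x] aff[OF less_trans[OF x(1) y(1)] y(2)] by simp
  then have "s > 0" using xy by (simp add: mult_less_cancel_left)
  then show ?thesis using aff by (rule sahara_piece_line)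
qed

text \<open>If there were no contact at \<open>x\<close>, the envelope would be affine between the contact points
  adjacent to \<open>x\<close>, hence equal to the chord of \<open>U\<close> there, and concavity of \<open>U\<close> would put that
  chord below \<open>U\<close>.\<close>

lemma contact_between:
  assumes ne: "concave_majorants U \<noteq> {}" and cont: "continuous_on UNIV U"
    and conc: "concave_on {p..q} U"
    and contact: "concave_envelope U p = U p" "concave_envelope U q = U q"
    and x: "p \<le> x" "x \<le> q"
  shows "concave_envelope U x = U x"
proof (rule ccontr)
  let ?E = "concave_envelope U"
  assume neq: "?E x \<noteq> U x"
  let ?C = "{t. ?E t = U t}"
  have C: "closed ?C" by (intro closed_Collect_eq envelope_continuous[OF ne] cont)
  \<comment> \<open>\<open>p'\<close> and \<open>q'\<close> are the contact points next to \<open>x\<close>.\<close>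
  have "compact ({p..x} \<inter> ?C)" "compact ({x..q} \<inter> ?C)"
    using C by (auto intro: compact_Int_closed)
  moreover have "p \<in> {p..x} \<inter> ?C" "q \<in> {x..q} \<inter> ?C" using contact x by auto
  ultimately obtain p' q' where p': "p' \<in> {p..x} \<inter> ?C" "\<And>t. t \<in> {p..x} \<inter> ?C \<Longrightarrow> t \<le> p'"
    and q': "q' \<in> {x..q} \<inter> ?C" "\<And>t. t \<in> {x..q} \<inter> ?C \<Longrightarrow> q' \<le> t"
    using compact_attains_sup[of "{p..x} \<inter> ?C"] compact_attains_inf[of "{x..q} \<inter> ?C"]
    by blast
  have ne': "p' \<noteq> x" "q' \<noteq> x" using p'(1) q'(1) neq by auto
  then have less: "p' < x" "x < q'" using p'(1) q'(1) by auto
  have "?E t \<noteq> U t" if "t \<in> {p'<..<q'}" for t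
  proof
    assume "?E t = U t"
    then have "t \<le> p' \<or> q' \<le> t"
      using p'(1) q'(1) p'(2)[of t] q'(2)[of t] that by (cases "t \<le> x") auto
    then show False using that by auto
  qed
  then obtain s c where aff: "\<And>t. t \<in> {p'<..<q'} \<Longrightarrow> ?E t = s * t + c"
    using envelope_affine_on[OF ne cont, of "{p'<..<q'}"] by auto
  have "closed {t. ?E t = s * t + c}"
    by (intro closed_Collect_eq envelope_continuous[OF ne] continuous_intros)
  then have "closure {p'<..<q'} \<subseteq> {t. ?E t = s * t + c}"
    using aff by (intro closure_minimal) auto
  then have aff': "?E t = s * t + c" if "t \<in> {p'..q'}" for t
    using that less by (auto simp: closure_greaterThanLessThan)
  have "U p' = s * p' + c" "U q' = s * q' + c"
    using aff'[of p'] aff'[of q'] p'(1) q'(1) less by auto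
  moreover have "s * q' + c - (s * p' + c) = s * (q' - p')" by (simp add: right_diff_distrib)
  ultimately have "chord U p' q' x = s * (x - p') + (s * p' + c)"
    using less by (simp add: chord_altdef)
  then have "chord U p' q' x = s * x + c" by (simp add: right_diff_distrib)
  moreover have "chord U p' q' x \<le> U x"
    using p'(1) q'(1) less by (intro concave_ge_chord[OF conc]) auto
  moreover have "?E x = s * x + c" using aff[of x] less by simp
  ultimately show False using envelope_ge[OF ne, of x] neq by simp
qed

text \<open>The contact points in the piece have infimum \<open>p\<close> and supremum \<open>q\<close> in the extended reals;
  the envelope is affine on \<open>(l, p)\<close> and \<open>(q, r)\<close> and agrees with \<open>U\<close> on \<open>(p, q)\<close>.\<close>

lemma envelope_chain_on_piece:
  assumes ps: "psahara U" and ne: "concave_majorants U \<noteq> {}"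
    and piece: "sahara_piece U l r" and "l < r"
  shows "sahara_chain (concave_envelope U) l r"
proof -
  let ?E = "concave_envelope U"
  define A where "A = {x. l < ereal x \<and> ereal x < r \<and> ?E x = U x}"
  have cont: "continuous_on UNIV U" using ps unfolding psahara_iff_chain by auto
  show ?thesis
  proof (cases "A = {}")
    case True
    then have "sahara_piece ?E l r"
      using \<open>l < r\<close> by (intro envelope_piece_without_contact[OF ps ne]) (auto simp: A_def)
    then show ?thesis by (rule sahara_chain_piece[OF \<open>l < r\<close>])
  next
    case False
    obtain \<alpha> \<beta> d \<gamma> u where par: "\<alpha> \<ge> 0" "\<beta> > 0" "\<gamma> > 0"
      and U: "\<And>x. l < ereal x \<Longrightarrow> ereal x < r \<Longrightarrow> U x = \<gamma> * sahara_hat x \<alpha> \<beta> d + u"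
      using piece unfolding sahara_piece_def by blast
    define p q where "p = Inf (ereal ` A)" and "q = Sup (ereal ` A)"
    have "l \<le> p" unfolding p_def by (rule Inf_greatest) (auto simp: A_def)
    have "q \<le> r" unfolding q_def by (rule Sup_least) (auto simp: A_def)
    have "p \<le> q" unfolding p_def q_def using False by (intro Inf_le_Sup) auto
    have outside: "?E x \<noteq> U x" if "l < ereal x" "ereal x < r" "ereal x < p \<or> q < ereal x" for x
    proof
      assume "?E x = U x"
      then have "ereal x \<in> ereal ` A" using that by (auto simp: A_def)
      then have "p \<le> ereal x" "ereal x \<le> q"
        unfolding p_def q_def by (auto intro: Inf_lower Sup_upper)
      then show False using that(3) by auto
    qed
    have left: "sahara_chain ?E l p" if "l < p"
    proof (intro sahara_chain_piece that envelope_piece_without_contact[OF ps ne])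
      fix x assume "l < ereal x" "ereal x < p"
      then show "?E x \<noteq> U x" using \<open>p \<le> q\<close> \<open>q \<le> r\<close> by (intro outside) auto
    qed
    have right: "sahara_chain ?E q r" if "q < r"
    proof (intro sahara_chain_piece that envelope_piece_without_contact[OF ps ne])
      fix x assume "q < ereal x" "ereal x < r"
      then show "?E x \<noteq> U x" using \<open>p \<le> q\<close> \<open>l \<le> p\<close> by (intro outside) auto
    qed
    have inside: "?E x = \<gamma> * sahara_hat x \<alpha> \<beta> d + u" if x: "p < ereal x" "ereal x < q" for x
    proof -
      obtain a b where "a \<in> A" "ereal a < ereal x" "b \<in> A" "ereal x < ereal b"
        using x unfolding p_def q_def Inf_less_iff less_Sup_iff by blast
      then have ab: "l < ereal a" "ereal b < r" "?E a = U a" "?E b = U b" "a \<le> x" "x \<le> b"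
        by (auto simp: A_def)
      have eq: "U t = \<gamma> * sahara_hat t \<alpha> \<beta> d + u" if "a \<le> t" "t \<le> b" for t
      proof (rule U)
        show "l < ereal t" using less_le_trans[OF ab(1), of "ereal t"] that(1) by simp
        show "ereal t < r" using le_less_trans[OF _ ab(2), of "ereal t"] that(2) by simp
      qed
      have "concave_on {a..b} U"
        unfolding concave_on_iff
      proof (intro conjI ballI allI impI)
        fix v w \<mu> \<nu> :: real
        assume *: "v \<in> {a..b}" "w \<in> {a..b}" "0 \<le> \<mu>" "0 \<le> \<nu>" "\<mu> + \<nu> = 1"
        have "\<mu> *\<^sub>R v + \<nu> *\<^sub>R w \<in> {a..b}"
          using convexD[OF convex_real_interval(5) *] .
        moreover have "\<mu> * (\<gamma> * sahara_hat v \<alpha> \<beta> d + u) + \<nu> * (\<gamma> * sahara_hat w \<alpha> \<beta> d + u)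
            \<le> \<gamma> * sahara_hat (\<mu> *\<^sub>R v + \<nu> *\<^sub>R w) \<alpha> \<beta> d + u"
          using sahara_form_concave[OF par(2,1,3), of d u] *(3-5)
          unfolding concave_on_iff by blast
        ultimately show "\<mu> * U v + \<nu> * U w \<le> U (\<mu> *\<^sub>R v + \<nu> *\<^sub>R w)"
          using *(1,2) by (simp only: eq atLeastAtMost_iff)
      qed (rule convex_real_interval)
      from contact_between[OF ne cont this ab(3-6)] eq[OF ab(5,6)] show ?thesis by simp
    qed
    have mid: "sahara_chain ?E p q" if "p < q"
    proof (rule sahara_chain_piece[OF that])
      show "sahara_piece ?E p q"
        unfolding sahara_piece_def using par inside by blast
    qed
    show ?thesis
    proof (rule sahara_chain_join_le[OF \<open>l \<le> p\<close> _ \<open>l < r\<close> left])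
      show "p \<le> r" using \<open>p \<le> q\<close> \<open>q \<le> r\<close> by (rule order_trans)
      show "sahara_chain ?E p r" if "p < r"
        by (rule sahara_chain_join_le[OF \<open>p \<le> q\<close> \<open>q \<le> r\<close> that mid right])
    qed
  qed
qed

lemma psahara_envelope:
  assumes ps: "psahara U" and ne: "concave_majorants U \<noteq> {}"
  shows "psahara (concave_envelope U)"
proof -
  obtain n and a :: "nat \<Rightarrow> ereal" where a: "a 0 = - \<infinity>" "a (Suc n) = \<infinity>"
      "\<And>k. k \<le> n \<Longrightarrow> a k < a (Suc k) \<and> sahara_piece U (a k) (a (Suc k))"
    using ps unfolding psahara_iff_chain sahara_chain_def by blast
  have "sahara_chain (concave_envelope U) (a 0) (a (Suc k))" if "k \<le> n" for k
    using that
  proof (induction k)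
    case 0
    then show ?case using a(3)[OF le0] by (intro envelope_chain_on_piece[OF ps ne]) auto
  next
    case (Suc k)
    then have "sahara_chain (concave_envelope U) (a (Suc k)) (a (Suc (Suc k)))"
      using a(3)[OF Suc.prems] by (intro envelope_chain_on_piece[OF ps ne]) auto
    with Suc.IH[OF Suc_leD[OF Suc.prems]] show ?case by (rule sahara_chain_join)
  qed
  from this[OF order_refl] have "sahara_chain (concave_envelope U) (- \<infinity>) \<infinity>"
    by (simp only: a(1,2))
  moreover have "mono U" using ps unfolding psahara_iff_chain by blast
  ultimately show ?thesis
    using envelope_mono[OF ne] envelope_continuous[OF ne] by (simp add: psahara_iff_chain)
qed

section \<open>A function outside the class with a PSAHARA envelope\<close>

text \<open>Lowering the identity at the single point \<open>0\<close> destroys monotonicity but not the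
  envelope, which concavity forces to be \<open>0\<close> at \<open>0\<close>.\<close>

lemma psahara_envelope_of_non_psahara:
  "\<exists>U. \<not> psahara U \<and> concave_majorants U \<noteq> {} \<and> psahara (concave_envelope U)"
proof -
  define U :: "real \<Rightarrow> real" where "U x = (if x = 0 then - 1 else x)" for x
  have "U (- 1 / 2) > U 0" by (simp add: U_def)
  then have "\<not> mono U" using monoD[of U "- 1 / 2" 0] by auto
  then have not_ps: "\<not> psahara U" unfolding psahara_iff_chain by blast
  have id: "(\<lambda>x. x) \<in> concave_majorants U"
    by (simp add: concave_majorants_def concave_on_ident U_def)
  have "concave_envelope U x = x" for x
  proof (rule antisym)
    show "concave_envelope U x \<le> x" using envelope_le[OF id] .
    show "x \<le> concave_envelope U x"
    proof (rule envelope_greatest)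
      fix h assume h: "h \<in> concave_majorants U"
      \<comment> \<open>Midpoint concavity between \<open>-1\<close> and \<open>1\<close> gives \<open>h 0 \<ge> 0\<close>.\<close>
      have "(1 - 1/2) * h (- 1) + 1/2 * h 1 \<le> h ((1 - 1/2) *\<^sub>R (- 1) + (1/2) *\<^sub>R 1)"
        using h by (intro concave_onD[of UNIV]) (auto simp: concave_majorants_def)
      then have "h (- 1) + h 1 \<le> 2 * h 0" by simp
      moreover have "U (- 1) \<le> h (- 1)" "U 1 \<le> h 1" "U x \<le> h x"
        using h by (auto simp: concave_majorants_def)
      ultimately show "x \<le> h x" by (auto simp: U_def split: if_splits)
    qed (use id in blast)
  qed
  then have "concave_envelope U = (\<lambda>x. x)" by blast
  moreover have "psahara (\<lambda>x. x)"
    unfolding psahara_iff_chain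
    by (intro conjI sahara_chain_piece sahara_piece_line[of 1 _ _ _ 0]) (auto simp: mono_def)
  ultimately show ?thesis using not_ps id by (intro exI[of _ U]) auto
qed

theorem proposition2:
  "(\<forall>U. psahara U \<and> concave_majorants U \<noteq> {} \<longrightarrow> psahara (concave_envelope U)) \<and>
   (\<exists>U. \<not> psahara U \<and> concave_majorants U \<noteq> {} \<and> psahara (concave_envelope U))"
  using psahara_envelope psahara_envelope_of_non_psahara by blast

end
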